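(* Any (probabilistic bounded error or deterministic) symbolic algorithm that computes the strongly connected components (SCCs) of a directed graph $G$ needs $\Omega\big(|SCCs(G)|+\sum_{C\in SCCs(G)} D_C\big)$ symbolic one-step operations, where $SCCs(G)$ is the set of SCCs of $G$ and $D_C$ is the diameter of the SCC $C$.
   Context: Symbolic model: the input is a finite directed graph $G=(V,E)$ (self-loops allowed), $n=|V|$. The algorithm knows $V$, but it can access $E$ only through the one-step operations $\mathrm{Pre}(S)=\{v\in V\mid \exists s\in S:(v,s)\in E\}$ and $\mathrm{Post}(S)=\{v\in V\mid \exists s\in S:(s,v)\in E\}$ applied to (adaptively chosen) sets $S\subseteq V$. All other computation, in particular basic set operations such as $\cup,\cap,\setminus,\subseteq,=$ on vertex sets, is unrestricted and not counted in lower bounds; any number of sets may be stored. A probabilistic bounded error algorithm may use random bits and must be correct with probability at least $2/3$ on every input. Convention for lower bounds: "needs $\Omega(g)$ one-step operations", for a parameter $g$ of the input, means: there is an absolute constant $c>0$ such that every (deterministic or probabilistic bounded error) symbolic algorithm solving the problem on all inputs performs, on inputs with arbitrarily large $g$, at least $c\cdot g$ one-step operations (worst case over its random choices). For an SCC $C$, $D_C$ is the diameter of the subgraph induced by $C$, i.e. the maximum distance $d(u,v)$ over $u,v\in C$ (so $D_C=0$ for a single-vertex SCC). *)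

theory Defs
  imports "HOL-Probability.Probability" "Graph_Theory.Graph_Theory"
begin

section \<open>Symbolic one-step operations\<close>

definition Pre_op :: "'v pair_pre_digraph \<Rightarrow> 'v set \<Rightarrow> 'v set" where
  "Pre_op G S = {v \<in> pverts G. \<exists>s\<in>S. (v, s) \<in> parcs G}"

definition Post_op :: "'v pair_pre_digraph \<Rightarrow> 'v set \<Rightarrow> 'v set" where
  "Post_op G S = {v \<in> pverts G. \<exists>s\<in>S. (s, v) \<in> parcs G}"


section \<open>Symbolic algorithms\<close>

text \<open>
  The behaviour of a symbolic algorithm on a fixed known vertex set, as a (possibly infinite)
  decision tree: it returns a result, asks for \<open>Pre S\<close> or \<open>Post S\<close> and continues depending
  on the answer, or flips a fair coin. A continuation is an arbitrary function of the answer and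
  thus may depend on everything seen before; this captures that all other
  computation, set operations and storage are unrestricted and free. The type is a codatatype so
  that algorithms need not terminate for every outcome of the coins.
\<close>

codatatype ('v, 'r) symb_tree =
    Return 'r
  | Pre "'v set" "'v set \<Rightarrow> ('v, 'r) symb_tree"
  | Post "'v set" "'v set \<Rightarrow> ('v, 'r) symb_tree"
  | Flip "bool \<Rightarrow> ('v, 'r) symb_tree"

text \<open>A symbolic algorithm knows the vertex set, but not the edges.\<close>

type_synonym ('v, 'r) symb_alg = "'v set \<Rightarrow> ('v, 'r) symb_tree"

text \<open>
  \<open>reaches G t \<omega> k t'\<close>: on input \<open>G\<close> and with the outcomes of the coin flips read from
  the tape \<open>\<omega>\<close>, the execution of \<open>t\<close> arrives at \<open>t'\<close> after exactly \<open>k\<close> one-step operations.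
\<close>

inductive reaches ::
  "'v pair_pre_digraph \<Rightarrow> ('v, 'r) symb_tree \<Rightarrow> bool stream \<Rightarrow> nat \<Rightarrow> ('v, 'r) symb_tree \<Rightarrow> bool"
  for G where
  here: "reaches G t \<omega> 0 t"
| Pre: "reaches G (f (Pre_op G S)) \<omega> k t' \<Longrightarrow> reaches G (Pre S f) \<omega> (Suc k) t'"
| Post: "reaches G (f (Post_op G S)) \<omega> k t' \<Longrightarrow> reaches G (Post S f) \<omega> (Suc k) t'"
| Flip: "reaches G (f (shd \<omega>)) (stl \<omega>) k t' \<Longrightarrow> reaches G (Flip f) \<omega> k t'"

definition returns ::
  "('v, 'r) symb_alg \<Rightarrow> 'v pair_pre_digraph \<Rightarrow> bool stream \<Rightarrow> 'r \<Rightarrow> bool" where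
  "returns A G \<omega> r \<longleftrightarrow> (\<exists>k. reaches G (A (pverts G)) \<omega> k (Return r))"

text \<open>
  The number of one-step operations performed, whether or not the execution terminates; in
  particular, an execution that flips coins forever is only charged for its one-step operations.
\<close>

definition one_step_ops ::
  "('v, 'r) symb_alg \<Rightarrow> 'v pair_pre_digraph \<Rightarrow> bool stream \<Rightarrow> enat" where
  "one_step_ops A G \<omega> = (SUP k\<in>{k. \<exists>t. reaches G (A (pverts G)) \<omega> k t}. enat k)"

definition worst_case_ops :: "('v, 'r) symb_alg \<Rightarrow> 'v pair_pre_digraph \<Rightarrow> enat" where
  "worst_case_ops A G = (SUP \<omega>. one_step_ops A G \<omega>)"


section \<open>Solving a problem\<close>

text \<open>
  A problem is given by the required result \<open>P G\<close> for each input graph \<open>G\<close>. Inputs are the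
  finite digraphs without parallel arcs; loops are allowed in \<^const>\<open>pair_fin_digraph\<close>.
\<close>

coinductive flip_free :: "('v, 'r) symb_tree \<Rightarrow> bool" where
  "flip_free (Return r)"
| "(\<And>X. flip_free (f X)) \<Longrightarrow> flip_free (Pre S f)"
| "(\<And>X. flip_free (f X)) \<Longrightarrow> flip_free (Post S f)"

definition deterministic_solves ::
  "('v, 'r) symb_alg \<Rightarrow> ('v pair_pre_digraph \<Rightarrow> 'r) \<Rightarrow> bool" where
  "deterministic_solves A P \<longleftrightarrow>
     (\<forall>V. flip_free (A V)) \<and> (\<forall>G. pair_fin_digraph G \<longrightarrow> (\<forall>\<omega>. returns A G \<omega> (P G)))"

definition coin_tape :: "bool stream measure" where
  "coin_tape = stream_space (measure_pmf (bernoulli_pmf (1/2)))"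

definition bounded_error_solves ::
  "('v, 'r) symb_alg \<Rightarrow> ('v pair_pre_digraph \<Rightarrow> 'r) \<Rightarrow> bool" where
  "bounded_error_solves A P \<longleftrightarrow>
     (\<forall>G. pair_fin_digraph G \<longrightarrow> \<P>(\<omega> in coin_tape. returns A G \<omega> (P G)) \<ge> 2/3)"

text \<open>The probability in \<^const>\<open>bounded_error_solves\<close> is that of a genuine event.\<close>

lemma reaches_finite_prefix:
  assumes "reaches G t \<omega> k t'"
  shows "\<exists>n. \<forall>\<omega>'. stake n \<omega>' = stake n \<omega> \<longrightarrow> reaches G t \<omega>' k t'"
  using assms
proof induction
  case (Flip f \<omega> k t')
  then obtain n where n: "stake n \<omega>' = stake n (stl \<omega>) \<Longrightarrow> reaches G (f (shd \<omega>)) \<omega>' k t'" for \<omega>'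
    by blast
  have "reaches G (Flip f) \<omega>' k t'" if "stake (Suc n) \<omega>' = stake (Suc n) \<omega>" for \<omega>'
    using that n[of "stl \<omega>'"] by (auto intro: reaches.Flip)
  then show ?case by blast
qed (blast intro: reaches.intros)+

lemma returns_event: "{\<omega> \<in> space coin_tape. returns A G \<omega> r} \<in> sets coin_tape"
proof -
  let ?I = "{(n, xs). \<forall>\<omega>. stake n \<omega> = xs \<longrightarrow> returns A G \<omega> r}"
  have sp: "space coin_tape = UNIV"
    by (simp add: coin_tape_def space_stream_space)
  have "{\<omega>. returns A G \<omega> r} = (\<Union>(n, xs)\<in>?I. {\<omega> \<in> space coin_tape. stake n \<omega> = xs})"
  proof (intro equalityI subsetI)
    fix \<omega> assume "\<omega> \<in> {\<omega>. returns A G \<omega> r}"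
    then obtain n where "\<forall>\<omega>'. stake n \<omega>' = stake n \<omega> \<longrightarrow> returns A G \<omega>' r"
      unfolding returns_def using reaches_finite_prefix by fast
    then have "(n, stake n \<omega>) \<in> ?I" by simp
    then show "\<omega> \<in> (\<Union>(n, xs)\<in>?I. {\<omega> \<in> space coin_tape. stake n \<omega> = xs})"
      using sp by blast
  qed auto
  moreover have "{\<omega> \<in> space coin_tape. stake n \<omega> = xs} \<in> sets coin_tape" for n xs
  proof -
    have "sets coin_tape = sets (stream_space (count_space UNIV))"
      unfolding coin_tape_def by (intro sets_stream_space_cong) simp
    then have "stake n \<in> measurable coin_tape (count_space UNIV)"
      using measurable_cong_sets measurable_stake by blast
    then show ?thesis by measurable
  qed
  ultimately show ?thesis
    using sp by (auto intro!: sets.countable_UN'' )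
qed


section \<open>Strongly connected components and diameters\<close>

definition SCCs :: "'v pair_pre_digraph \<Rightarrow> 'v set set" where
  "SCCs G = pre_digraph.sccs_verts (with_proj G)"

definition digraph_dist :: "('v, 'e) pre_digraph \<Rightarrow> 'v \<Rightarrow> 'v \<Rightarrow> ereal" where
  "digraph_dist H u v = wf_digraph.\<mu> H (\<lambda>_. 1) u v"

definition digraph_diameter :: "('v, 'e) pre_digraph \<Rightarrow> ereal" where
  "digraph_diameter H = (SUP u\<in>verts H. SUP v\<in>verts H. digraph_dist H u v)"

text \<open>On SCCs of finite digraphs, the diameter is a nonnegative finite value of type \<^typ>\<open>ereal\<close>.\<close>

lemma SCC_diameter_finite:
  assumes "pair_fin_digraph G" "C \<in> SCCs G"
  shows "0 \<le> digraph_diameter (with_proj G \<restriction> C)" "digraph_diameter (with_proj G \<restriction> C) < \<infinity>"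
proof -
  interpret pair_fin_digraph G by fact
  interpret M: max_reachable_set "with_proj G" C
    using assms by unfold_locales (auto simp: SCCs_def)
  have sub: "C \<subseteq> pverts G"
    using M.reach_in reachable_in_verts(1) by blast
  interpret H: wf_digraph "with_proj G \<restriction> C"
    using sub by (intro wf_digraphI_induced[OF induced_induce]) simp
  have "finite C" using sub pair_finite_verts finite_subset by blast
  have fin: "digraph_dist (with_proj G \<restriction> C) u v < \<infinity>" if uv: "u \<in> C" "v \<in> C" for u v
  proof -
    from M.reachable_induced[OF uv M.reach_in[OF uv]]
    obtain p where "H.awalk u p v" using H.reachable_awalk by blast
    then have "digraph_dist (with_proj G \<restriction> C) u v \<le> ereal (awalk_cost (\<lambda>_. 1) p)"
      unfolding digraph_dist_def by (rule H.min_cost_le_walk_cost)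
    then show ?thesis by (rule order_le_less_trans) simp
  qed
  have nonneg: "0 \<le> digraph_dist (with_proj G \<restriction> C) u v" for u v
    unfolding digraph_dist_def H.\<mu>_def
    by (rule INF_greatest) (use H.pos_cost_pos_awalk_cost in auto)
  have "finite C" "C \<noteq> {}" using \<open>finite C\<close> M.not_empty by auto
  then show "digraph_diameter (with_proj G \<restriction> C) < \<infinity>"
    unfolding digraph_diameter_def using fin
    by (simp add: finite_Sup_less_iff del: ereal_infty_less(1))
  obtain u where "u \<in> C" using M.not_empty by auto
  then have "digraph_dist (with_proj G \<restriction> C) u u \<le> digraph_diameter (with_proj G \<restriction> C)"
    unfolding digraph_diameter_def by (auto intro!: SUP_upper2[of u])
  then show "0 \<le> digraph_diameter (with_proj G \<restriction> C)"
    using nonneg order_trans by blast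
qed

definition scc_parameter :: "'v pair_pre_digraph \<Rightarrow> ereal" where
  "scc_parameter G =
     ereal (real (card (SCCs G))) + (\<Sum>C\<in>SCCs G. digraph_diameter (with_proj G \<restriction> C))"

end

theory Submission
  imports Defs
begin

text \<open>
  Consider the linear order with all loops on \<open>{..<2n}\<close>, where moreover the arc from \<open>2i + 1\<close> back
  to \<open>2i\<close> is present iff \<open>i\<close> lies in a hidden set \<open>B \<subseteq> {..<n}\<close>. The image \<open>Post S\<close> is the up-set of
  \<open>m = min S\<close>, except that it also contains \<open>m - 1\<close> if the back arc from \<open>m\<close> exists; dually for
  \<open>Pre\<close>. So every one-step operation reveals at most one bit, whereas the SCCs determine \<open>B\<close>.
  For a fixed coin tape, \<open>k\<close> operations thus give the right answer on at most \<open>2 ^ k\<close> of the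
  \<open>2 ^ n\<close> inputs, and averaging over the tapes forces \<open>k \<ge> n\<close> for some input. All SCCs have at most
  two vertices, so the parameter lies between \<open>n\<close> and \<open>4n\<close>.
\<close>

section \<open>Operations with binary answers\<close>

text \<open>Targets are restricted to \<open>Return r'\<close>: for an arbitrary target, the rule
  \<open>here\<close> would also let the run stop at an inner node.\<close>

lemma reaches_Return_iff:
  shows "reaches G (Return r) \<omega> k (Return r') \<longleftrightarrow> k = 0 \<and> r' = r"
    and "reaches G (Pre S f) \<omega> k (Return r') \<longleftrightarrow>
      (\<exists>j. k = Suc j \<and> reaches G (f (Pre_op G S)) \<omega> j (Return r'))"
    and "reaches G (Post S f) \<omega> k (Return r') \<longleftrightarrow>
      (\<exists>j. k = Suc j \<and> reaches G (f (Post_op G S)) \<omega> j (Return r'))"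
    and "reaches G (Flip h) \<omega> k (Return r') \<longleftrightarrow>
      reaches G (h (shd \<omega>)) (stl \<omega>) k (Return r')"
  by (subst reaches.simps, simp)+

lemma card_le_two_fibres:
  assumes "finite X" "\<And>x. x \<in> X \<Longrightarrow> g x \<in> {a, b}"
    and "\<And>c. card {x \<in> X. g x = c} \<le> 2 ^ m"
  shows "card X \<le> 2 ^ Suc m"
proof -
  have "card X \<le> card ({x \<in> X. g x = a} \<union> {x \<in> X. g x = b})"
    using assms(1,2) by (intro card_mono) auto
  also have "\<dots> \<le> card {x \<in> X. g x = a} + card {x \<in> X. g x = b}"
    by (rule card_Un_le)
  also have "\<dots> \<le> 2 ^ m + 2 ^ m" by (intro add_mono assms(3))
  finally show ?thesis by simp
qed

text \<open>On a fixed tape the coins are decided, so only operations separate inputs, each into at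
  most two classes by its answer. At a leaf, injectivity of \<open>P\<close> leaves a single correct
  input. Hence the count is that of the leaves of a binary tree of depth \<open>m\<close>.\<close>

lemma card_correct_le:
  fixes G :: "'a \<Rightarrow> 'v pair_pre_digraph" and P :: "'a \<Rightarrow> 'r"
  assumes U: "finite U" and inj: "inj_on P U"
    and pre: "\<And>S. \<exists>a b. \<forall>x\<in>U. Pre_op (G x) S \<in> {a, b}"
    and post: "\<And>S. \<exists>a b. \<forall>x\<in>U. Post_op (G x) S \<in> {a, b}"
    and "X \<subseteq> U" and "\<forall>x\<in>X. \<exists>k\<le>m. reaches (G x) t \<omega> k (Return (P x))"
  shows "card X \<le> 2 ^ m"
  using assms(5,6)
proof (induction m arbitrary: t \<omega> X rule: less_induct)
  case (less m)
  have fin: "finite X" using less.prems(1) U finite_subset by blast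
  show ?case
  proof (cases "X = {}")
    case False
    then obtain x0 where x0: "x0 \<in> X" by blast
    with less.prems(2) obtain k where "reaches (G x0) t \<omega> k (Return (P x0))" by blast
    then show ?thesis using less.prems(2)
    \<comment> \<open>Flips do not decrease \<open>m\<close>, and \<open>t\<close> may be infinite,
      so the outer induction alone cannot pass them. The run on \<open>x0\<close> is finite, which
      justifies an inner induction along it.\<close>
    proof (induction t \<omega> k "Return (P x0) :: ('v, 'r) symb_tree")
      case (here \<omega>)
      then have "P x = P x0" if "x \<in> X" for x
        using that unfolding reaches_Return_iff by blast
      then have "x = y" if "x \<in> X" "y \<in> X" for x y
        using that inj less.prems(1) by (metis inj_on_def subsetD)
      then have "card X \<le> 1"
        unfolding One_nat_def card_le_Suc0_iff_eq[OF fin] by blast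
      also have "\<dots> \<le> 2 ^ m" by simp
      finally show ?case .
    next
      case (Pre f S \<omega> k)
      have step: "\<exists>j. Suc j \<le> m \<and> reaches (G x) (f (Pre_op (G x) S)) \<omega> j (Return (P x))"
        if x: "x \<in> X" for x
        using bspec[OF Pre.prems x] unfolding reaches_Return_iff by blast
      obtain m' where m: "m = Suc m'" using step[OF x0] by (cases m) auto
      obtain a b where ab: "\<forall>x\<in>U. Pre_op (G x) S \<in> {a, b}"
        using pre[of S] by blast
      \<comment> \<open>The outer hypothesis for \<open>m' < m\<close> covers every answer
        \<open>c\<close>, not only the one that \<open>x0\<close> receives.\<close>
      have "card {x \<in> X. Pre_op (G x) S = c} \<le> 2 ^ m'" for c
      proof (rule less.IH)
        show "\<forall>x\<in>{x \<in> X. Pre_op (G x) S = c}. \<exists>k\<le>m'. reaches (G x) (f c) \<omega> k (Return (P x))"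
        proof
          fix x assume "x \<in> {x \<in> X. Pre_op (G x) S = c}"
          with step[of x] m show "\<exists>k\<le>m'. reaches (G x) (f c) \<omega> k (Return (P x))" by auto
        qed
      qed (use less.prems(1) m in auto)
      moreover have "\<And>x. x \<in> X \<Longrightarrow> Pre_op (G x) S \<in> {a, b}"
        using ab less.prems(1) by blast
      ultimately show ?case
        unfolding m by (intro card_le_two_fibres[OF fin, of "\<lambda>x. Pre_op (G x) S" a b])
    next
      case (Post f S \<omega> k)
      have step: "\<exists>j. Suc j \<le> m \<and> reaches (G x) (f (Post_op (G x) S)) \<omega> j (Return (P x))"
        if x: "x \<in> X" for x
        using bspec[OF Post.prems x] unfolding reaches_Return_iff by blast
      obtain m' where m: "m = Suc m'" using step[OF x0] by (cases m) auto
      obtain a b where ab: "\<forall>x\<in>U. Post_op (G x) S \<in> {a, b}"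
        using post[of S] by blast
      have "card {x \<in> X. Post_op (G x) S = c} \<le> 2 ^ m'" for c
      proof (rule less.IH)
        show "\<forall>x\<in>{x \<in> X. Post_op (G x) S = c}. \<exists>k\<le>m'. reaches (G x) (f c) \<omega> k (Return (P x))"
        proof
          fix x assume "x \<in> {x \<in> X. Post_op (G x) S = c}"
          with step[of x] m show "\<exists>k\<le>m'. reaches (G x) (f c) \<omega> k (Return (P x))" by auto
        qed
      qed (use less.prems(1) m in auto)
      moreover have "\<And>x. x \<in> X \<Longrightarrow> Post_op (G x) S \<in> {a, b}"
        using ab less.prems(1) by blast
      ultimately show ?case
        unfolding m by (intro card_le_two_fibres[OF fin, of "\<lambda>x. Post_op (G x) S" a b])
    next
      case (Flip f \<omega> k)
      \<comment> \<open>All inputs read the same tape and take the same branch, so \<open>X\<close>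
        and \<open>m\<close> stay as they are and the inner hypothesis applies.\<close>
      from Flip.prems have "\<forall>x\<in>X. \<exists>k\<le>m. reaches (G x) (f (shd \<omega>)) (stl \<omega>) k (Return (P x))"
        by (simp add: reaches_Return_iff)
      then show ?case by (rule Flip.hyps)
    qed
  qed simp
qed

section \<open>Averaging over coin tapes\<close>

lemma prob_space_coin_tape: "prob_space coin_tape"
  unfolding coin_tape_def
  by (intro prob_space.prob_space_stream_space prob_space_measure_pmf)

lemma deterministic_solves_imp_bounded_error:
  assumes "deterministic_solves A P" shows "bounded_error_solves A P"
proof -
  interpret prob_space coin_tape by (rule prob_space_coin_tape)
  show ?thesis
    using assms prob_space by (auto simp: deterministic_solves_def bounded_error_solves_def)
qed

lemma reaches_le_worst_case_ops:
  assumes "reaches G (A (pverts G)) \<omega> k t"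
  shows "enat k \<le> worst_case_ops A G"
proof -
  have "enat k \<le> one_step_ops A G \<omega>"
    unfolding one_step_ops_def using assms by (intro SUP_upper) blast
  also have "\<dots> \<le> worst_case_ops A G"
    unfolding worst_case_ops_def by (rule SUP_upper) simp
  finally show ?thesis .
qed

text \<open>The easy direction of Yao's principle for the uniform distribution on \<open>U\<close>.
  If \<open>m\<close> operations always sufficed, the expected number of correctly answered inputs
  would be at most \<open>2 ^ m\<close>, tape by tape, but at least two thirds of
  \<open>card U\<close>, input by input.\<close>

lemma binary_answers_lower_bound:
  fixes G :: "'a \<Rightarrow> 'v pair_pre_digraph" and P :: "'v pair_pre_digraph \<Rightarrow> 'r"
  assumes A: "bounded_error_solves A P" and U: "finite U"
    and G: "\<And>x. x \<in> U \<Longrightarrow> pair_fin_digraph (G x)" "\<And>x. x \<in> U \<Longrightarrow> pverts (G x) = V"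
    and inj: "inj_on (\<lambda>x. P (G x)) U"
    and pre: "\<And>S. \<exists>a b. \<forall>x\<in>U. Pre_op (G x) S \<in> {a, b}"
    and post: "\<And>S. \<exists>a b. \<forall>x\<in>U. Post_op (G x) S \<in> {a, b}"
    and m: "3 * 2 ^ m < 2 * card U"
  shows "\<exists>x\<in>U. enat m < worst_case_ops A (G x)"
proof (rule ccontr)
  assume "\<not> ?thesis"
  then have le: "worst_case_ops A (G x) \<le> enat m" if "x \<in> U" for x
    using that by (auto simp: not_less)
  interpret prob_space coin_tape by (rule prob_space_coin_tape)
  define E where "E x = {\<omega> \<in> space coin_tape. returns A (G x) \<omega> (P (G x))}" for x
  have E: "E x \<in> events" for x
    unfolding E_def by (rule returns_event)
  have count: "card {x \<in> U. \<omega> \<in> E x} \<le> 2 ^ m" for \<omega>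
  \<comment> \<open>All inputs share the vertex set \<open>V\<close>, so every run starts in the
    same tree \<open>A V\<close>.\<close>
  proof (rule card_correct_le[OF U inj pre post, where t = "A V" and \<omega> = \<omega>])
    show "\<forall>x\<in>{x \<in> U. \<omega> \<in> E x}. \<exists>k\<le>m. reaches (G x) (A V) \<omega> k (Return (P (G x)))"
    proof
      fix x assume "x \<in> {x \<in> U. \<omega> \<in> E x}"
      then have x: "x \<in> U" and "returns A (G x) \<omega> (P (G x))" by (auto simp: E_def)
      then obtain k where k: "reaches (G x) (A (pverts (G x))) \<omega> k (Return (P (G x)))"
        unfolding returns_def by blast
      have "k \<le> m"
        using order_trans[OF reaches_le_worst_case_ops[of "G x" A, OF k] le[OF x]] by simp
      then show "\<exists>k\<le>m. reaches (G x) (A V) \<omega> k (Return (P (G x)))"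
        using k G(2)[OF x] by auto
    qed
  qed auto
  have "2 / 3 * real (card U) = (\<Sum>x\<in>U. 2 / 3)" by simp
  also have "\<dots> \<le> (\<Sum>x\<in>U. prob (E x))"
    using A G(1) by (intro sum_mono) (auto simp: bounded_error_solves_def E_def)
  also have "\<dots> = (\<Sum>x\<in>U. expectation (indicator (E x)))"
    using E by simp
  also have "\<dots> = expectation (\<lambda>\<omega>. \<Sum>x\<in>U. indicator (E x) \<omega>)"
    using E by (intro Bochner_Integration.integral_sum[symmetric])
      (simp add: emeasure_eq_measure)
  also have "\<dots> \<le> expectation (\<lambda>\<omega>. 2 ^ m)"
  proof (rule integral_mono)
    show "integrable coin_tape (\<lambda>\<omega>. \<Sum>x\<in>U. indicator (E x) \<omega> :: real)"
      using E by (intro Bochner_Integration.integrable_sum) (simp add: emeasure_eq_measure)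
    fix \<omega>
    have "(\<Sum>x\<in>U. indicator (E x) \<omega> :: real) = real (card {x \<in> U. \<omega> \<in> E x})"
      using U by (simp add: indicator_def sum.If_cases Int_def)
    also have "\<dots> \<le> 2 ^ m"
      using count[of \<omega>] by (metis of_nat_le_iff of_nat_numeral of_nat_power)
    finally show "(\<Sum>x\<in>U. indicator (E x) \<omega> :: real) \<le> 2 ^ m" .
  qed simp
  also have "\<dots> = 2 ^ m" by (simp add: prob_space)
  finally have "2 * real (card U) \<le> 3 * 2 ^ m" by simp
  then have "real (2 * card U) \<le> real (3 * 2 ^ m)" by simp
  with m show False by linarith
qed


section \<open>Digraphs whose arcs form a preorder\<close>

text \<open>Here reachability coincides with adjacency, so SCCs can be read off the arcs.\<close>

locale pair_preorder_digraph = pair_fin_digraph +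
  assumes refl_arcs: "v \<in> pverts G \<Longrightarrow> (v, v) \<in> parcs G"
    and trans_arcs: "trans (parcs G)"
begin

lemma reachable_iff_arc: "u \<rightarrow>\<^sup>*\<^bsub>with_proj G\<^esub> v \<longleftrightarrow> (u, v) \<in> parcs G"
proof
  assume "u \<rightarrow>\<^sup>*\<^bsub>with_proj G\<^esub> v"
  then show "(u, v) \<in> parcs G"
  proof (induction rule: reachable_induct)
    case (step x y)
    then show ?case using trans_arcs by (auto dest: transD)
  qed (simp add: refl_arcs)
next
  assume "(u, v) \<in> parcs G"
  then show "u \<rightarrow>\<^sup>*\<^bsub>with_proj G\<^esub> v" by (intro reachable_adjI) simp
qed

lemma SCCs_eq: "SCCs G = (\<lambda>u. {v. (u, v) \<in> parcs G \<and> (v, u) \<in> parcs G}) ` pverts G"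
  by (simp add: SCCs_def sccs_verts_conv_scc_of scc_of_def reachable_iff_arc)

lemma finite_SCCs: "finite (SCCs G)"
  by (simp add: SCCs_eq)

lemma SCC_arc:
  assumes "C \<in> SCCs G" "u \<in> C" "v \<in> C"
  shows "(u, v) \<in> parcs G"
  using assms trans_arcs by (auto simp: SCCs_eq dest: transD)

text \<open>By transitivity an SCC is a complete digraph, so a single arc is a walk between any two
  of its vertices; loops cover \<open>u = v\<close> without a case split.\<close>

lemma SCC_diameter_le_1:
  assumes C: "C \<in> SCCs G"
  shows "digraph_diameter (with_proj G \<restriction> C) \<le> 1"
proof -
  interpret H: wf_digraph "with_proj G \<restriction> C"
    by unfold_locales (auto simp: induce_subgraph_def)
  have "digraph_dist (with_proj G \<restriction> C) u v \<le> 1" if uv: "u \<in> C" "v \<in> C" for u v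
  proof -
    have "H.awalk u [(u, v)] v"
      using uv SCC_arc[OF C uv] unfolding H.awalk_def
      by (simp add: pre_digraph.cas.simps induce_subgraph_def)
    from H.min_cost_le_walk_cost[OF this, of "\<lambda>_. 1"] show ?thesis
      by (simp add: digraph_dist_def awalk_cost_def one_ereal_def)
  qed
  then show ?thesis
    unfolding digraph_diameter_def by (auto intro!: SUP_least)
qed

text \<open>Each diameter lies between 0 and 1, so the parameter is the number of SCCs up to a
  factor 2.\<close>

lemma scc_parameter_bounds:
  shows "ereal (real (card (SCCs G))) \<le> scc_parameter G"
    and "scc_parameter G \<le> ereal (real (2 * card (SCCs G)))"
proof -
  have "0 \<le> (\<Sum>C\<in>SCCs G. digraph_diameter (with_proj G \<restriction> C))"
    using SCC_diameter_finite(1) pair_fin_digraph by (intro sum_nonneg) blast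
  then show "ereal (real (card (SCCs G))) \<le> scc_parameter G"
    unfolding scc_parameter_def by (simp add: add_increasing2)
  have "(\<Sum>C\<in>SCCs G. digraph_diameter (with_proj G \<restriction> C)) \<le> (\<Sum>C\<in>SCCs G. ereal 1)"
    using SCC_diameter_le_1 by (intro sum_mono) (simp add: one_ereal_def)
  also have "\<dots> = ereal (real (card (SCCs G)))"
    by (simp only: sum_ereal) simp
  finally have "scc_parameter G \<le> ereal (real (card (SCCs G))) + ereal (real (card (SCCs G)))"
    unfolding scc_parameter_def by (rule add_left_mono)
  then show "scc_parameter G \<le> ereal (real (2 * card (SCCs G)))" by simp
qed

end


section \<open>Linear orders with hidden back arcs\<close>

definition hidden_pairs :: "nat \<Rightarrow> nat set \<Rightarrow> nat pair_pre_digraph" where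
  "hidden_pairs n B =
     \<lparr>pverts = {..<2 * n},
      parcs = {(u, v). u < 2 * n \<and> v < 2 * n \<and>
                 (u \<le> v \<or> u = Suc v \<and> even v \<and> v div 2 \<in> B)}\<rparr>"

lemma pverts_hidden_pairs: "pverts (hidden_pairs n B) = {..<2 * n}"
  by (simp add: hidden_pairs_def)

lemma arc_hidden_pairs_iff:
  "(u, v) \<in> parcs (hidden_pairs n B) \<longleftrightarrow>
     u < 2 * n \<and> v < 2 * n \<and> (u \<le> v \<or> u = Suc v \<and> even v \<and> v div 2 \<in> B)"
  by (simp add: hidden_pairs_def)

lemma pair_preorder_digraph_hidden_pairs: "pair_preorder_digraph (hidden_pairs n B)"
proof
  have "parcs (hidden_pairs n B) \<subseteq> {..<2 * n} \<times> {..<2 * n}"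
    by (auto simp: hidden_pairs_def)
  then show "finite (parcs (hidden_pairs n B))"
    by (rule finite_subset) simp
  show "trans (parcs (hidden_pairs n B))"
  proof (rule transI)
    fix u v w
    assume "(u, v) \<in> parcs (hidden_pairs n B)" "(v, w) \<in> parcs (hidden_pairs n B)"
    then show "(u, w) \<in> parcs (hidden_pairs n B)"
      \<comment> \<open>Two back arcs never follow each other, as each leads from an odd to an even
        vertex. A back arc combined with a forward arc that is not a loop ends no lower than it
        starts.\<close>
      unfolding arc_hidden_pairs_iff by (cases "v = w") auto
  qed
qed (auto simp: hidden_pairs_def)

section \<open>Answers of the one-step operations\<close>

lemma Post_hidden_pairs_binary: "\<exists>a b. \<forall>B\<in>\<B>. Post_op (hidden_pairs n B) S \<in> {a, b}"
\<comment> \<open>A query may contain elements that are not vertices; these have no arcs.\<close>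
proof (cases "S \<inter> {..<2 * n} = {}")
  case True
  then have "\<forall>B\<in>\<B>. Post_op (hidden_pairs n B) S \<in> {{}, {}}"
    by (auto simp: Post_op_def arc_hidden_pairs_iff)
  then show ?thesis by blast
next
  case False
  define m where "m = Min (S \<inter> {..<2 * n})"
  have m: "m \<in> S" "m < 2 * n" and least: "\<And>s. s \<in> S \<Longrightarrow> s < 2 * n \<Longrightarrow> m \<le> s"
    using Min_in[OF _ False] by (auto simp: m_def)
  \<comment> \<open>A back arc from some \<open>s > m\<close> ends at \<open>s - 1\<close>, which
    the up-set of \<open>m\<close> already contains; only the one from \<open>m\<close> itself is
    visible.\<close>
  have "Post_op (hidden_pairs n B) S =
      {m..<2 * n} \<union> {v. m = Suc v \<and> even v \<and> v div 2 \<in> B}" for B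
  proof (intro set_eqI iffI)
    fix v assume "v \<in> Post_op (hidden_pairs n B) S"
    then obtain s where s: "v < 2 * n" "s \<in> S" "(s, v) \<in> parcs (hidden_pairs n B)"
      by (auto simp: Post_op_def pverts_hidden_pairs)
    with least[of s] have "m \<le> s" by (auto simp: arc_hidden_pairs_iff)
    with s show "v \<in> {m..<2 * n} \<union> {v. m = Suc v \<and> even v \<and> v div 2 \<in> B}"
      by (cases "m \<le> v") (auto simp: arc_hidden_pairs_iff)
  qed (use m in \<open>auto simp: Post_op_def pverts_hidden_pairs arc_hidden_pairs_iff\<close>)
  \<comment> \<open>For \<open>m = 0\<close> the set is empty, so the truncated value of
    \<open>m - 1\<close> does no harm.\<close>
  moreover have "{v. m = Suc v \<and> even v \<and> v div 2 \<in> B} \<in> {{}, {m - 1}}" for B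
    by auto
  ultimately have "\<forall>B\<in>\<B>. Post_op (hidden_pairs n B) S \<in>
      {{m..<2 * n} \<union> {}, {m..<2 * n} \<union> {m - 1}}"
    by (metis (no_types, lifting) empty_iff insert_iff)
  then show ?thesis by blast
qed

lemma Pre_hidden_pairs_binary: "\<exists>a b. \<forall>B\<in>\<B>. Pre_op (hidden_pairs n B) S \<in> {a, b}"
proof (cases "S \<inter> {..<2 * n} = {}")
  case True
  then have "\<forall>B\<in>\<B>. Pre_op (hidden_pairs n B) S \<in> {{}, {}}"
    by (auto simp: Pre_op_def arc_hidden_pairs_iff)
  then show ?thesis by blast
next
  case False
  define m where "m = Max (S \<inter> {..<2 * n})"
  have m: "m \<in> S" "m < 2 * n" and greatest: "\<And>s. s \<in> S \<Longrightarrow> s < 2 * n \<Longrightarrow> s \<le> m"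
    using Max_in[OF _ False] by (auto simp: m_def)
  \<comment> \<open>Dually, a back arc into some \<open>s < m\<close> starts at
    \<open>Suc s\<close>, which is at most \<open>m\<close>.\<close>
  have "Pre_op (hidden_pairs n B) S =
      {..m} \<union> {v. v = Suc m \<and> v < 2 * n \<and> even m \<and> m div 2 \<in> B}" for B
  proof (intro set_eqI iffI)
    fix v assume "v \<in> Pre_op (hidden_pairs n B) S"
    then obtain s where s: "v < 2 * n" "s \<in> S" "(v, s) \<in> parcs (hidden_pairs n B)"
      by (auto simp: Pre_op_def pverts_hidden_pairs)
    with greatest[of s] have "s \<le> m" by (auto simp: arc_hidden_pairs_iff)
    with s show "v \<in> {..m} \<union> {v. v = Suc m \<and> v < 2 * n \<and> even m \<and> m div 2 \<in> B}"
      by (cases "s = m") (auto simp: arc_hidden_pairs_iff)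
  qed (use m in \<open>auto simp: Pre_op_def pverts_hidden_pairs arc_hidden_pairs_iff\<close>)
  moreover have "{v. v = Suc m \<and> v < 2 * n \<and> even m \<and> m div 2 \<in> B} \<in> {{}, {Suc m}}" for B
    by auto
  ultimately have "\<forall>B\<in>\<B>. Pre_op (hidden_pairs n B) S \<in> {{..m} \<union> {}, {..m} \<union> {Suc m}}"
    by (metis (no_types, lifting) empty_iff insert_iff)
  then show ?thesis by blast
qed

section \<open>Recovering the hidden set and counting the SCCs\<close>

text \<open>Decodes \<open>B\<close> from the result: the forward arc of each pair is always
  present, so only the back arc decides.\<close>

lemma SCCs_hidden_pairs_iff:
  assumes "i < n"
  shows "(\<exists>C\<in>SCCs (hidden_pairs n B). 2 * i \<in> C \<and> Suc (2 * i) \<in> C) \<longleftrightarrow> i \<in> B"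
proof -
  interpret pair_preorder_digraph "hidden_pairs n B"
    by (rule pair_preorder_digraph_hidden_pairs)
  show ?thesis
  proof
    assume "\<exists>C\<in>SCCs (hidden_pairs n B). 2 * i \<in> C \<and> Suc (2 * i) \<in> C"
    then have "(Suc (2 * i), 2 * i) \<in> parcs (hidden_pairs n B)"
      using SCC_arc by blast
    then show "i \<in> B" by (simp add: arc_hidden_pairs_iff)
  next
    assume "i \<in> B"
    with assms show "\<exists>C\<in>SCCs (hidden_pairs n B). 2 * i \<in> C \<and> Suc (2 * i) \<in> C"
      unfolding SCCs_eq by (auto simp: pverts_hidden_pairs arc_hidden_pairs_iff
          intro!: bexI[of _ "2 * i"])
  qed
qed

lemma inj_on_SCCs_hidden_pairs: "inj_on (\<lambda>B. SCCs (hidden_pairs n B)) (Pow {..<n})"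
proof (rule inj_onI)
  fix B B' assume "B \<in> Pow {..<n}" "B' \<in> Pow {..<n}"
    and "SCCs (hidden_pairs n B) = SCCs (hidden_pairs n B')"
  then show "B = B'"
    using SCCs_hidden_pairs_iff[of _ n B] SCCs_hidden_pairs_iff[of _ n B'] by auto
qed

text \<open>Distinct even vertices are never mutually adjacent, because back arcs join vertices of
  different parity; this gives \<open>n\<close> different SCCs.\<close>

lemma card_SCCs_hidden_pairs:
  shows "n \<le> card (SCCs (hidden_pairs n B))" and "card (SCCs (hidden_pairs n B)) \<le> 2 * n"
proof -
  interpret pair_preorder_digraph "hidden_pairs n B"
    by (rule pair_preorder_digraph_hidden_pairs)
  let ?E = "parcs (hidden_pairs n B)"
  let ?scc = "\<lambda>u. {v. (u, v) \<in> ?E \<and> (v, u) \<in> ?E}"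
  show "card (SCCs (hidden_pairs n B)) \<le> 2 * n"
    unfolding SCCs_eq pverts_hidden_pairs
    using card_image_le[of "{..<2 * n}" ?scc] by simp
  have "inj_on (\<lambda>i. ?scc (2 * i)) {..<n}"
  proof (rule inj_onI)
    fix i j assume ij: "i \<in> {..<n}" "j \<in> {..<n}" "?scc (2 * i) = ?scc (2 * j)"
    have "2 * i \<in> ?scc (2 * i)"
      using ij(1) by (simp add: arc_hidden_pairs_iff)
    then have "2 * i \<in> ?scc (2 * j)" unfolding ij(3) .
    then have "2 * j \<le> 2 * i \<or> 2 * j = Suc (2 * i)" "2 * i \<le> 2 * j \<or> 2 * i = Suc (2 * j)"
      unfolding arc_hidden_pairs_iff by blast+
    then show "i = j" by presburger
  qed
  then have "n = card ((\<lambda>i. ?scc (2 * i)) ` {..<n})"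
    by (simp add: card_image)
  also have "\<dots> \<le> card (SCCs (hidden_pairs n B))"
    using finite_SCCs by (intro card_mono) (auto simp: SCCs_eq pverts_hidden_pairs)
  finally show "n \<le> card (SCCs (hidden_pairs n B))" .
qed

lemma hidden_pairs_lower_bound:
  assumes A: "bounded_error_solves A SCCs"
  shows "\<exists>B. enat n \<le> worst_case_ops A (hidden_pairs n B)"
proof (cases n)
  case 0
  then show ?thesis by (simp add: zero_enat_def[symmetric])
next
  case (Suc m)
  have "\<exists>B\<in>Pow {..<n}. enat m < worst_case_ops A (hidden_pairs n B)"
  proof (rule binary_answers_lower_bound[OF A])
    \<comment> \<open>With \<open>n = Suc m\<close> this is \<open>3 * 2 ^ m < 4 * 2 ^ m\<close>, so
      more than \<open>m\<close>, hence at least \<open>n\<close>, operations are forced.\<close>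
    show "3 * 2 ^ m < 2 * card (Pow {..<n})"
      by (simp add: card_Pow Suc)
    show "pair_fin_digraph (hidden_pairs n B)" for B
      using pair_preorder_digraph_hidden_pairs by (rule pair_preorder_digraph.axioms)
  qed (simp_all only: inj_on_SCCs_hidden_pairs Pre_hidden_pairs_binary Post_hidden_pairs_binary
      pverts_hidden_pairs finite_Pow_iff finite_lessThan)
  then show ?thesis
    unfolding Suc eSuc_enat[symmetric] by (auto intro: ileI1)
qed

theorem theorem3p7:
  shows "\<exists>c::real. c > 0 \<and>
    (\<forall>A :: (nat, nat set set) symb_alg.
       deterministic_solves A SCCs \<or> bounded_error_solves A SCCs \<longrightarrow>
       (\<forall>N::nat. \<exists>G. pair_fin_digraph G \<and>
          ereal (real N) \<le> scc_parameter G \<and>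
          ereal c * scc_parameter G \<le> ereal_of_enat (worst_case_ops A G)))"
\<comment> \<open>There are at most \<open>2 * N\<close> SCCs, so the parameter is at most
  \<open>4 * N\<close>, against at least \<open>N\<close> operations.\<close>
proof (intro exI[of _ "1 / 4"] conjI allI impI)
  fix A :: "(nat, nat set set) symb_alg" and N :: nat
  assume "deterministic_solves A SCCs \<or> bounded_error_solves A SCCs"
  then have "bounded_error_solves A SCCs"
    using deterministic_solves_imp_bounded_error by blast
  then obtain B where B: "enat N \<le> worst_case_ops A (hidden_pairs N B)"
    using hidden_pairs_lower_bound by blast
  interpret pair_preorder_digraph "hidden_pairs N B"
    by (rule pair_preorder_digraph_hidden_pairs)
  show "\<exists>G. pair_fin_digraph G \<and> ereal (real N) \<le> scc_parameter G \<and>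
      ereal (1 / 4) * scc_parameter G \<le> ereal_of_enat (worst_case_ops A G)"
  proof (intro exI conjI)
    show "pair_fin_digraph (hidden_pairs N B)" ..
    show "ereal (real N) \<le> scc_parameter (hidden_pairs N B)"
      using scc_parameter_bounds(1) card_SCCs_hidden_pairs(1)
      by (meson ereal_less_eq(3) of_nat_le_iff order_trans)
    have "scc_parameter (hidden_pairs N B) \<le> ereal (real (4 * N))"
      using scc_parameter_bounds(2) card_SCCs_hidden_pairs(2)[of N B]
      by (elim order_trans) simp
    then have "ereal (1 / 4) * scc_parameter (hidden_pairs N B) \<le> ereal (1 / 4) * ereal (real (4 * N))"
      by (intro ereal_mult_left_mono) auto
    also have "\<dots> = ereal_of_enat (enat N)" by simp
    also have "\<dots> \<le> ereal_of_enat (worst_case_ops A (hidden_pairs N B))"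
      using B by (simp only: ereal_of_enat_le_iff)
    finally show "ereal (1 / 4) * scc_parameter (hidden_pairs N B)
        \<le> ereal_of_enat (worst_case_ops A (hidden_pairs N B))" .
  qed
qed simp

end
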